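(* Let $(\mathcal V,\mathcal E)$ be a finite graph, let $y_i\in\mathbb R$ and $w_i\ge 0$ for $i\in\mathcal V$, let $\lambda_{i,j}>0$ for $(i,j)\in\mathcal E$, and let $$Q(g)=\tfrac12\sum_{i\in\mathcal V}w_i(g_i-y_i)^2+\sum_{(i,j)\in\mathcal E}\lambda_{i,j}|g_j-g_i|,\qquad g\in\mathbb R^{\mathcal V}.$$ Suppose there exist a fit $f\in\mathbb R^{\mathcal V}$ and a set of edges $\mathcal A\subseteq\mathcal E$ such that $f_i=f_j$ for all $(i,j)\in\mathcal A$ and $(\mathcal V,\mathcal A)$ is acyclic. Suppose also that there are values $c_{i,j}$, $(i,j)\in\mathcal E$, such that, with $m_k,u_k,m_{I,J},u_{I,J}$ the quantities defined from $\mathcal A$ and $c$ in the context: 1. for all $(i,j)\in\mathcal E$, $c_{i,j}=\operatorname{sign}(f_j-f_i)$ or $f_i=f_j$; 2. $c_{i,j}=\pm1$ if $(i,j)\in\mathcal A$; 3. $u_kf_k=m_k$ for all $k\in\mathcal V$; 4. $\left|u_{I,J}f_I-(m_{I,J}-c_{I,J}\lambda_{I,J})\right|\le\lambda_{I,J}$ for all $(I,J)\in\mathcal A$. Then $f$ minimizes $Q$.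
   Context: The graph is undirected and has at most one edge joining any pair of vertices. Each edge is recorded as an ordered pair with an arbitrary fixed orientation. "Acyclic" and "connected" refer to the underlying undirected graph. Given $\mathcal A\subseteq\mathcal E$ with $(\mathcal V,\mathcal A)$ acyclic, for $k\in\mathcal V$ let $$\mathcal R(k)=\{i\in\mathcal V: i\text{ is connected to }k\text{ in }(\mathcal V,\mathcal A)\}.$$ For an edge $(I,J)\in\mathcal A$ let $$\mathcal R(I,J)=\{i\in\mathcal R(I): i\text{ is connected to }I\text{ in }(\mathcal V,\mathcal A\setminus\{(I,J)\})\}.$$ For $a=k\in\mathcal V$ or $a=I,J$ with $(I,J)\in\mathcal A$, define $$m_a=\sum_{i\in\mathcal R(a)}\Big(w_iy_i+\sum_{j:(i,j)\in\mathcal E}c_{i,j}\lambda_{i,j}-\sum_{j:(j,i)\in\mathcal E}c_{j,i}\lambda_{j,i}\Big),\qquad u_a=\sum_{i\in\mathcal R(a)}w_i .$$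
   Formalization: The hypothesis |c_{i,j}| ≤ 1 for all (i,j) in E is added; it only restricts edges outside A with f_i = f_j, where c is otherwise unconstrained and the claim fails (two vertices, one edge, A empty, w = λ = 1, y = (-2,2), f = 0, c = 2). *)

theory Defs
  imports Complex_Main
begin

text \<open>
  An undirected graph is given by a set of vertices together with a relation containing each
  edge in exactly one, arbitrarily chosen, orientation. The relation of undirected adjacency is
  therefore the symmetric closure.
\<close>

definition adjacency :: "('v \<times> 'v) set \<Rightarrow> ('v \<times> 'v) set" where
  "adjacency A = A \<union> A\<inverse>"

definition oriented_graph :: "'v set \<Rightarrow> ('v \<times> 'v) set \<Rightarrow> bool" where
  "oriented_graph V E \<longleftrightarrow>
     finite V \<and> E \<subseteq> V \<times> V \<and> (\<forall>i j. (i, j) \<in> E \<longrightarrow> i \<noteq> j \<and> (j, i) \<notin> E)"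

text \<open>
  The cycle is listed without repeating its first vertex. The bound on the length keeps a single
  edge, traversed back and forth, from counting as a cycle.
\<close>

definition undirected_cycle :: "('v \<times> 'v) set \<Rightarrow> 'v list \<Rightarrow> bool" where
  "undirected_cycle A p \<longleftrightarrow>
     3 \<le> length p \<and> distinct p \<and>
     successively (\<lambda>i j. (i, j) \<in> adjacency A) p \<and> (last p, hd p) \<in> adjacency A"

definition undirected_acyclic :: "('v \<times> 'v) set \<Rightarrow> bool" where
  "undirected_acyclic A \<longleftrightarrow> (\<nexists>p. undirected_cycle A p)"

definition connected_in :: "('v \<times> 'v) set \<Rightarrow> 'v \<Rightarrow> 'v \<Rightarrow> bool" where
  "connected_in A i k \<longleftrightarrow> (i, k) \<in> (adjacency A)\<^sup>*"

definition region :: "'v set \<Rightarrow> ('v \<times> 'v) set \<Rightarrow> 'v \<Rightarrow> 'v set" where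
  "region V A k = {i \<in> V. connected_in A i k}"

definition edge_region :: "'v set \<Rightarrow> ('v \<times> 'v) set \<Rightarrow> 'v \<Rightarrow> 'v \<Rightarrow> 'v set" where
  "edge_region V A I J = {i \<in> region V A I. connected_in (A - {(I, J)}) i I}"

text \<open>
  The quantities \<open>m\<^sub>a\<close> and \<open>u\<^sub>a\<close> depend on the index \<open>a\<close> only through the set of
  vertices \<open>R = \<R>(a)\<close>, which is the parameter used here.
\<close>

definition region_m ::
  "('v \<times> 'v) set \<Rightarrow> ('v \<Rightarrow> real) \<Rightarrow> ('v \<Rightarrow> real) \<Rightarrow> ('v \<Rightarrow> 'v \<Rightarrow> real) \<Rightarrow>
   ('v \<Rightarrow> 'v \<Rightarrow> real) \<Rightarrow> 'v set \<Rightarrow> real" where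
  "region_m E w y lam c R =
     (\<Sum>i\<in>R. w i * y i + (\<Sum>j\<in>{j. (i, j) \<in> E}. c i j * lam i j)
                      - (\<Sum>j\<in>{j. (j, i) \<in> E}. c j i * lam j i))"

definition region_u :: "('v \<Rightarrow> real) \<Rightarrow> 'v set \<Rightarrow> real" where
  "region_u w R = (\<Sum>i\<in>R. w i)"

text \<open>
  An element of \<open>\<real>\<^sup>V\<close> is represented by a total function; the objective only looks at its
  values on \<open>V\<close>.
\<close>

definition objective ::
  "'v set \<Rightarrow> ('v \<times> 'v) set \<Rightarrow> ('v \<Rightarrow> real) \<Rightarrow> ('v \<Rightarrow> real) \<Rightarrow> ('v \<Rightarrow> 'v \<Rightarrow> real) \<Rightarrow>
   ('v \<Rightarrow> real) \<Rightarrow> real" where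
  "objective V E w y lam g =
     1 / 2 * (\<Sum>i\<in>V. w i * (g i - y i)\<^sup>2) + (\<Sum>(i, j)\<in>E. lam i j * \<bar>g j - g i\<bar>)"

end

theory Submission
  imports Defs
begin

text \<open>
  Write \<open>b\<^sub>i\<close> for the residual of the stationarity equation at vertex \<open>i\<close> when \<open>c\<close> is used as the
  subgradient of the penalty. Condition 3 says that \<open>b\<close> sums to zero over every component of
  \<open>A\<close>, so \<open>b\<close> is the divergence of a flow \<open>t\<close> supported on \<open>A\<close>. Since \<open>A\<close> is acyclic, an edge
  \<open>(I, J)\<close> is the only one leaving its side \<open>\<R>(I, J)\<close>, so \<open>t\<^sub>I\<^sub>,\<^sub>J\<close> is the sum of \<open>b\<close> over that
  side. Condition 4 then says exactly that \<open>c - t / \<lambda>\<close> stays within \<open>[-1, 1]\<close> on \<open>A\<close>; this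
  corrected subgradient satisfies the stationarity equation, and convexity gives optimality.
\<close>

section \<open>Connectedness, simple paths and bridges\<close>

lemma adjacency_sym: "(i, j) \<in> adjacency A \<Longrightarrow> (j, i) \<in> adjacency A"
  by (auto simp: adjacency_def)

lemma connected_in_sym: "connected_in A i k \<Longrightarrow> connected_in A k i"
  unfolding connected_in_def
  by (meson adjacency_sym symD symI sym_rtrancl)

lemma connected_in_trans: "connected_in A i j \<Longrightarrow> connected_in A j k \<Longrightarrow> connected_in A i k"
  unfolding connected_in_def by (rule rtrancl_trans)

lemma connected_in_edge: "(i, j) \<in> A \<Longrightarrow> connected_in A i j"
  unfolding connected_in_def adjacency_def by auto

lemma connected_in_const:
  assumes "connected_in A i k" and "\<And>i j. (i, j) \<in> A \<Longrightarrow> h i = h j"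
  shows "h i = h k"
  using assms(1) unfolding connected_in_def
  by (induction rule: rtrancl_induct) (auto simp: adjacency_def dest: assms(2))

lemma connected_in_mono:
  assumes "connected_in A i k" and "A \<subseteq> B"
  shows "connected_in B i k"
proof -
  have "adjacency A \<subseteq> adjacency B"
    using assms(2) by (auto simp: adjacency_def)
  then show ?thesis
    using assms(1) rtrancl_mono unfolding connected_in_def by blast
qed

text \<open>Loop erasure, one step at a time: if the next vertex already lies on the path, the path
  is cut back to it, otherwise it is appended. Cycles are lists of distinct vertices, so a mere walk
  would not do.\<close>

lemma rtrancl_distinct_path:
  assumes "(x, y) \<in> r\<^sup>*"
  obtains p where "p \<noteq> []" "hd p = x" "last p = y" "distinct p"
    "successively (\<lambda>i j. (i, j) \<in> r) p"
proof -
  from assms have "\<exists>p. p \<noteq> [] \<and> hd p = x \<and> last p = y \<and> distinct p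
      \<and> successively (\<lambda>i j. (i, j) \<in> r) p"
  proof (induction rule: rtrancl_induct)
    case base
    show ?case by (rule exI[of _ "[x]"]) simp
  next
    case (step y z)
    then obtain p where p: "p \<noteq> []" "hd p = x" "last p = y" "distinct p"
      "successively (\<lambda>i j. (i, j) \<in> r) p" by blast
    show ?case
    proof (cases "z \<in> set p")
      case True
      then obtain q q' where q: "p = (q @ [z]) @ q'"
        using split_list[of z p] by auto
      show ?thesis
        using p(2,4,5) unfolding q successively_append_iff[of _ "q @ [z]"]
        by (intro exI[of _ "q @ [z]"]) (auto simp: hd_append)
    next
      case False
      then show ?thesis
        using p step.hyps(2) by (intro exI[of _ "p @ [z]"]) (auto simp: successively_append_iff)
    qed
  qed
  then show ?thesis using that by blast
qed

text \<open>A simple path from \<open>J\<close> to \<open>I\<close> avoiding the edge would be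
  closed by \<open>(I, J)\<close> into a cycle.\<close>

lemma undirected_acyclic_bridge:
  assumes "undirected_acyclic A" "(I, J) \<in> A" "(J, I) \<notin> A" "I \<noteq> J"
  shows "\<not> connected_in (A - {(I, J)}) J I"
proof
  assume "connected_in (A - {(I, J)}) J I"
  then obtain p where p: "p \<noteq> []" "hd p = J" "last p = I" "distinct p"
    "successively (\<lambda>i j. (i, j) \<in> adjacency (A - {(I, J)})) p"
    unfolding connected_in_def by (rule rtrancl_distinct_path)
  \<comment> \<open>A single vertex would force \<open>I = J\<close>; two vertices would make
    \<open>I\<close> and \<open>J\<close> adjacent without \<open>(I, J)\<close>, hence through
    \<open>(J, I)\<close>.\<close>
  have "3 \<le> length p"
  proof (rule ccontr)
    assume "\<not> 3 \<le> length p"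
    then consider a where "p = [a]" | a b where "p = [a, b]"
      using p(1) by (cases p rule: list.exhaust; cases "tl p"; cases "tl (tl p)") auto
    then show False
      using p(2,3,5) assms(2-4) by cases (auto simp: adjacency_def)
  qed
  moreover have "successively (\<lambda>i j. (i, j) \<in> adjacency A) p"
    using p(5) by (rule successively_mono) (auto simp: adjacency_def)
  ultimately have "undirected_cycle A p"
    using p assms(2) by (simp add: undirected_cycle_def adjacency_def)
  then show False
    using assms(1) by (auto simp: undirected_acyclic_def)
qed

section \<open>Representing the residual by a flow on the forest\<close>

text \<open>The components partition \<open>V\<close> and \<open>h\<close> is constant on each, so
  the component of \<open>k\<close> contributes \<open>h k\<close> times a zero sum.\<close>

lemma sum_regions_eq_0:
  fixes b h :: "'v \<Rightarrow> real"
  assumes "finite V" and b: "\<And>k. k \<in> V \<Longrightarrow> sum b (region V A k) = 0"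
    and h: "\<And>i j. (i, j) \<in> A \<Longrightarrow> h i = h j"
  shows "(\<Sum>i\<in>V. b i * h i) = 0"
proof -
  let ?C = "region V A ` V"
  have V: "\<Union> ?C = V"
    by (auto simp: region_def connected_in_def)
  have disj: "R \<inter> R' = {}" if "R \<in> ?C" "R' \<in> ?C" "R \<noteq> R'" for R R'
    using that unfolding region_def by (auto; meson connected_in_sym connected_in_trans)
  have "(\<Sum>i\<in>\<Union> ?C. b i * h i) = (\<Sum>R\<in>?C. \<Sum>i\<in>R. b i * h i)"
    using sum.Union_disjoint[of ?C "\<lambda>i. b i * h i"] disj assms(1)
    by (auto simp: region_def)
  also have "\<dots> = 0"
  proof (rule sum.neutral, safe)
    fix k assume k: "k \<in> V"
    have "(\<Sum>i\<in>region V A k. b i * h i) = (\<Sum>i\<in>region V A k. b i * h k)"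
      using connected_in_const[of A _ k h, OF _ h] by (auto simp: region_def intro!: sum.cong)
    then show "(\<Sum>i\<in>region V A k. b i * h i) = 0"
      using b[OF k] by (simp flip: sum_distrib_right)
  qed
  finally show ?thesis by (simp add: V)
qed

text \<open>
  The annihilator of the common kernel of finitely many functionals is their span. The
  hypothesis on \<open>L\<close> is linearity, in a form that needs no vector space structure on functions.
\<close>

lemma functional_eq_flow:
  fixes L :: "('v \<Rightarrow> real) \<Rightarrow> real"
  assumes "finite A"
    and "\<And>h k r. L (\<lambda>i. h i - r * k i) = L h - r * L k"
    and "\<And>h. (\<And>i j. (i, j) \<in> A \<Longrightarrow> h i = h j) \<Longrightarrow> L h = 0"
  obtains t where "\<And>h. L h = (\<Sum>(i, j)\<in>A. t i j * (h i - h j))"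
proof -
  have "\<exists>t. \<forall>h. L h = (\<Sum>(i, j)\<in>A. t i j * (h i - h j))"
    using assms
  proof (induction A arbitrary: L rule: finite_induct)
    case empty
    then show ?case by simp
  next
    case (insert e A)
    note lin = insert.prems(1) and ker = insert.prems(2)
    obtain I J where e: "e = (I, J)" by (cases e)
    \<comment> \<open>Among the functions that are constant along \<open>A\<close>, those with
      \<open>h I = h J\<close> form a subspace of codimension at most one, and \<open>L\<close>
      vanishes on it.\<close>
    have "\<exists>s. \<forall>h. (\<forall>(i, j)\<in>A. h i = h j) \<longrightarrow> L h = s * (h I - h J)"
    proof (cases "\<exists>k :: 'v \<Rightarrow> real. (\<forall>(i, j)\<in>A. k i = k j) \<and> k I \<noteq> k J")
      case True
      then obtain k :: "'v \<Rightarrow> real" where k: "\<forall>(i, j)\<in>A. k i = k j" "k I \<noteq> k J" by blast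
      have "L h = L k / (k I - k J) * (h I - h J)" if h: "\<forall>(i, j)\<in>A. h i = h j" for h
      proof -
        \<comment> \<open>This \<open>r\<close> gives \<open>h - r * k\<close> equal values at
          \<open>I\<close> and \<open>J\<close>, which puts it in the kernel of
          \<open>L\<close>.\<close>
        define r where "r = (h I - h J) / (k I - k J)"
        have "h I - h J = r * (k I - k J)"
          using k(2) by (simp add: r_def)
        then have IJ: "h I - r * k I = h J - r * k J"
          by (simp add: algebra_simps)
        have "L (\<lambda>i. h i - r * k i) = 0"
        proof (rule ker)
          fix i j assume "(i, j) \<in> insert e A"
          then show "h i - r * k i = h j - r * k j"
          proof
            assume "(i, j) \<in> A"
            then have "h i = h j" "k i = k j" using h k(1) by blast+
            then show ?thesis by simp
          qed (use e IJ in simp)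
        qed
        then show ?thesis using lin[of h r k] by (simp add: r_def)
      qed
      then show ?thesis by blast
    next
      case False
      have "L h = 0" if "\<forall>(i, j)\<in>A. h i = h j" for h
        using that False e by (intro ker) auto
      then show ?thesis by (intro exI[of _ 0]) simp
    qed
    then obtain s where s: "\<And>h. \<forall>(i, j)\<in>A. h i = h j \<Longrightarrow> L h = s * (h I - h J)" by blast
    \<comment> \<open>With the contribution of the new edge removed, the functional vanishes on
      everything constant along the smaller \<open>A\<close>.\<close>
    have "\<exists>t. \<forall>h. L h - s * (h I - h J) = (\<Sum>(i, j)\<in>A. t i j * (h i - h j))"
    proof (rule insert.IH)
      show "L (\<lambda>i. h i - r * k i) - s * (h I - r * k I - (h J - r * k J))
          = L h - s * (h I - h J) - r * (L k - s * (k I - k J))" for h k r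
        unfolding lin by (simp add: algebra_simps)
      show "L h - s * (h I - h J) = 0" if "\<And>i j. (i, j) \<in> A \<Longrightarrow> h i = h j" for h
        using s[of h] that by auto
    qed
    then obtain t where t: "\<And>h. L h - s * (h I - h J) = (\<Sum>(i, j)\<in>A. t i j * (h i - h j))"
      by blast
    define t' where "t' = (\<lambda>i j. if (i, j) = e then s else t i j)"
    have "(\<Sum>(i, j)\<in>A. t' i j * (h i - h j)) = (\<Sum>(i, j)\<in>A. t i j * (h i - h j))" for h
      using insert.hyps(2) by (intro sum.cong) (auto simp: t'_def)
    then have "L h = (\<Sum>(i, j)\<in>insert e A. t' i j * (h i - h j))" for h
      using insert.hyps t[of h] by (simp add: e t'_def)
    then show ?case by blast
  qed
  then show ?thesis using that by blast
qed

text \<open>The flow identity is tested on the indicator of the side of \<open>I\<close>. Any other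
  edge has both ends on one side and contributes zero, while \<open>(I, J)\<close> crosses because
  it is a bridge.\<close>

lemma flow_eq_cut_sum:
  fixes b :: "'v \<Rightarrow> real"
  assumes "finite V" and sub: "A \<subseteq> V \<times> V" and orient: "\<And>i j. (i, j) \<in> A \<Longrightarrow> i \<noteq> j \<and> (j, i) \<notin> A"
    and acyclic: "undirected_acyclic A"
    and flow: "\<And>h. (\<Sum>i\<in>V. b i * h i) = (\<Sum>(i, j)\<in>A. t i j * (h i - h j))"
    and IJ: "(I, J) \<in> A"
  shows "t I J = sum b (edge_region V A I J)"
proof -
  let ?S = "edge_region V A I J"
  let ?h = "\<lambda>i. of_bool (i \<in> ?S) :: real"
  have S: "?S = {i \<in> V. connected_in (A - {(I, J)}) i I}"
    unfolding edge_region_def region_def by (auto elim: connected_in_mono)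
  have finA: "finite A"
    using sub assms(1) by (meson finite_SigmaI finite_subset)
  have I: "I \<in> ?S"
    using IJ sub by (auto simp: S connected_in_def)
  have J: "J \<notin> ?S"
    using undirected_acyclic_bridge[OF acyclic IJ] orient[OF IJ] by (auto simp: S)
  have same_side: "i \<in> ?S \<longleftrightarrow> j \<in> ?S" if "(i, j) \<in> A - {(I, J)}" for i j
    using that sub connected_in_edge[OF that] unfolding S
    by (blast intro: connected_in_sym connected_in_trans)
  have "sum b ?S = (\<Sum>i\<in>V. b i * ?h i)"
    using assms(1) by (simp add: sum.inter_filter[symmetric] S of_bool_def if_distrib cong: if_cong)
  also have "\<dots> = (\<Sum>(i, j)\<in>A. t i j * (?h i - ?h j))"
    by (rule flow)
  also have "\<dots> = t I J * (?h I - ?h J) + (\<Sum>(i, j)\<in>A - {(I, J)}. t i j * (?h i - ?h j))"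
    by (subst sum.remove[OF finA IJ]) simp
  also have "(\<Sum>(i, j)\<in>A - {(I, J)}. t i j * (?h i - ?h j)) = 0"
    by (rule sum.neutral) (use same_side in force)
  finally show ?thesis using I J by simp
qed

section \<open>Stationarity and optimality\<close>

text \<open>Summation by parts: an edge \<open>(i, j)\<close> is counted at its tail with weight
  \<open>h i\<close> and at its head with weight \<open>- h j\<close>.\<close>

lemma sum_divergence:
  fixes F :: "'v \<Rightarrow> 'v \<Rightarrow> real"
  assumes "finite V" "E \<subseteq> V \<times> V"
  shows "(\<Sum>i\<in>V. ((\<Sum>j\<in>{j. (i, j) \<in> E}. F i j) - (\<Sum>j\<in>{j. (j, i) \<in> E}. F j i)) * h i)
    = (\<Sum>(i, j)\<in>E. F i j * (h i - h j))"
proof -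
  have fin: "finite {j. (i, j) \<in> E}" "finite {j. (j, i) \<in> E}" for i
    using assms by (auto intro: finite_subset[OF _ assms(1)])
  have "(\<Sum>i\<in>V. \<Sum>j\<in>{j. (i, j) \<in> E}. F i j * h i) = (\<Sum>(i, j)\<in>E. F i j * h i)"
    using assms fin
    by (subst sum.Sigma) (auto intro!: sum.cong)
  moreover have "(\<Sum>i\<in>V. \<Sum>j\<in>{j. (j, i) \<in> E}. F j i * h i) = (\<Sum>(i, j)\<in>E. F i j * h j)"
    using assms fin
    by (subst sum.Sigma)
      (auto intro!: sum.reindex_bij_witness[of _ prod.swap prod.swap])
  ultimately show ?thesis
    by (simp add: left_diff_distrib right_diff_distrib sum_subtractf sum_distrib_right
        case_prod_unfold)
qed

theorem theorem1:
  fixes V :: "'v set" and E A :: "('v \<times> 'v) set"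
    and y w f :: "'v \<Rightarrow> real" and lam c :: "'v \<Rightarrow> 'v \<Rightarrow> real"
  assumes graph: "oriented_graph V E"
    and w_nonneg: "\<And>i. i \<in> V \<Longrightarrow> 0 \<le> w i"
    and lam_pos: "\<And>i j. (i, j) \<in> E \<Longrightarrow> 0 < lam i j"
    and A_subset: "A \<subseteq> E"
    and A_const: "\<And>i j. (i, j) \<in> A \<Longrightarrow> f i = f j"
    and A_acyclic: "undirected_acyclic A"
    and c_bound: "\<And>i j. (i, j) \<in> E \<Longrightarrow> \<bar>c i j\<bar> \<le> 1"
    and c_sign: "\<And>i j. (i, j) \<in> E \<Longrightarrow> c i j = sgn (f j - f i) \<or> f i = f j"
    and c_active: "\<And>i j. (i, j) \<in> A \<Longrightarrow> c i j = 1 \<or> c i j = - 1"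
    and vertex_eq: "\<And>k. k \<in> V \<Longrightarrow>
      region_u w (region V A k) * f k = region_m E w y lam c (region V A k)"
    and edge_bound: "\<And>I J. (I, J) \<in> A \<Longrightarrow>
      \<bar>region_u w (edge_region V A I J) * f I
        - (region_m E w y lam c (edge_region V A I J) - c I J * lam I J)\<bar> \<le> lam I J"
  shows "\<forall>g :: 'v \<Rightarrow> real. objective V E w y lam f \<le> objective V E w y lam g"
proof
  fix g :: "'v \<Rightarrow> real"
  \<comment> \<open>Minus the formal derivative of the objective in coordinate \<open>i\<close> at
    \<open>f\<close>, with \<open>c\<close> as the derivative of the absolute values.\<close>
  define b where "b i = w i * (y i - f i)
    + ((\<Sum>j\<in>{j. (i, j) \<in> E}. c i j * lam i j) - (\<Sum>j\<in>{j. (j, i) \<in> E}. c j i * lam j i))" for i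
  have finV: "finite V" and EV: "E \<subseteq> V \<times> V"
    and orient: "\<And>i j. (i, j) \<in> E \<Longrightarrow> i \<noteq> j \<and> (j, i) \<notin> E"
    using graph by (auto simp: oriented_graph_def)
  have finE: "finite E"
    using EV finV by (meson finite_SigmaI finite_subset)
  \<comment> \<open>Stated for subsets of a component, since it serves both whole components and the
    sides of an edge; \<open>f\<close> is constant on either.\<close>
  have sum_b: "sum b R = region_m E w y lam c R - region_u w R * f k"
    if "R \<subseteq> region V A k" for R k
  proof -
    have "f i = f k" if "i \<in> R" for i
      using connected_in_const[of A i k f] A_const \<open>R \<subseteq> region V A k\<close> that
      by (auto simp: region_def)
    then show ?thesis
      unfolding region_m_def region_u_def b_def sum_distrib_right sum_subtractf[symmetric]
      by (intro sum.cong) (auto simp: algebra_simps)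
  qed
  have b_component: "sum b (region V A k) = 0" if "k \<in> V" for k
    using sum_b[OF order_refl] vertex_eq[OF that] by simp
  obtain t where t: "\<And>h. (\<Sum>i\<in>V. b i * h i) = (\<Sum>(i, j)\<in>A. t i j * (h i - h j))"
  proof (rule functional_eq_flow)
    show "finite A"
      using A_subset finE by (rule finite_subset)
    show "(\<Sum>i\<in>V. b i * (h i - r * k i)) = (\<Sum>i\<in>V. b i * h i) - r * (\<Sum>i\<in>V. b i * k i)"
      for h k r
      by (simp add: sum_distrib_left right_diff_distrib sum_subtractf mult.left_commute)
    show "(\<Sum>i\<in>V. b i * h i) = 0" if "\<And>i j. (i, j) \<in> A \<Longrightarrow> h i = h j" for h
      using finV b_component that by (rule sum_regions_eq_0)
  qed (rule that)
  have t_bound: "\<bar>c I J * lam I J - t I J\<bar> \<le> lam I J" if IJ: "(I, J) \<in> A" for I J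
  proof -
    have "t I J = sum b (edge_region V A I J)"
      using finV _ _ A_acyclic t IJ
      by (rule flow_eq_cut_sum) (use A_subset EV orient in blast)+
    also have "\<dots> = region_m E w y lam c (edge_region V A I J)
        - region_u w (edge_region V A I J) * f I"
      by (rule sum_b) (auto simp: edge_region_def)
    finally show ?thesis
      using edge_bound[OF IJ] by (simp add: algebra_simps)
  qed
  \<comment> \<open>The corrected subgradient, scaled by \<open>lam\<close> to avoid
    division.\<close>
  define z where "z i j = c i j * lam i j - (if (i, j) \<in> A then t i j else 0)" for i j
  have stationary: "(\<Sum>i\<in>V. w i * (f i - y i) * h i) = (\<Sum>(i, j)\<in>E. z i j * (h i - h j))" for h
  proof -
    have "(\<Sum>(i, j)\<in>E. (if (i, j) \<in> A then t i j else 0) * (h i - h j))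
        = (\<Sum>(i, j)\<in>A. t i j * (h i - h j))"
      using A_subset finE by (intro sum.mono_neutral_cong_right) auto
    moreover have "(\<Sum>i\<in>V. b i * h i) = (\<Sum>(i, j)\<in>E. c i j * lam i j * (h i - h j))
        - (\<Sum>i\<in>V. w i * (f i - y i) * h i)"
      using sum_divergence[OF finV EV, of "\<lambda>i j. c i j * lam i j" h]
      by (simp add: b_def algebra_simps sum.distrib sum_subtractf)
    ultimately show ?thesis
      using t[of h] by (simp add: z_def left_diff_distrib sum_subtractf case_prod_unfold)
  qed
  have subgradient: "lam i j * \<bar>f j - f i\<bar>
      \<le> lam i j * \<bar>g j - g i\<bar> + z i j * ((g i - f i) - (g j - f j))" if ij: "(i, j) \<in> E" for i j
  proof -
    have lam: "0 < lam i j" using lam_pos[OF ij] .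
    have z: "\<bar>z i j\<bar> \<le> lam i j"
      using t_bound[of i j] c_bound[OF ij] lam by (auto simp: z_def abs_mult)
    \<comment> \<open>Both sides vanish if \<open>f i = f j\<close>, so the correction on
      \<open>A\<close> is invisible here; otherwise \<open>c i j\<close> is the sign.\<close>
    have "z i j * (f j - f i) = lam i j * \<bar>f j - f i\<bar>"
      using c_sign[OF ij] A_const[of i j]
      by (cases "f i = f j") (auto simp: z_def abs_sgn)
    moreover have "z i j * (g j - g i) \<le> lam i j * \<bar>g j - g i\<bar>"
      using mult_right_mono[OF z, of "\<bar>g j - g i\<bar>"] abs_ge_self[of "z i j * (g j - g i)"]
      by (simp add: abs_mult)
    ultimately show ?thesis by (simp add: algebra_simps)
  qed
  have square: "w i * (f i - y i)\<^sup>2 / 2 + w i * (f i - y i) * (g i - f i)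
      \<le> w i * (g i - y i)\<^sup>2 / 2" if "i \<in> V" for i
  proof -
    \<comment> \<open>Exact expansion around \<open>f i\<close>; dropping the last term is where
      nonnegative weights enter.\<close>
    have "w i * (g i - y i)\<^sup>2 / 2
        = w i * (f i - y i)\<^sup>2 / 2 + w i * (f i - y i) * (g i - f i) + w i * (g i - f i)\<^sup>2 / 2"
      by (simp add: power2_eq_square field_simps)
    then show ?thesis using w_nonneg[OF that] by simp
  qed
  have "(\<Sum>i\<in>V. w i * (f i - y i)\<^sup>2 / 2) + (\<Sum>i\<in>V. w i * (f i - y i) * (g i - f i))
      \<le> (\<Sum>i\<in>V. w i * (g i - y i)\<^sup>2 / 2)"
    unfolding sum.distrib[symmetric] by (rule sum_mono) (rule square)
  moreover have "(\<Sum>(i, j)\<in>E. lam i j * \<bar>f j - f i\<bar>) \<le> (\<Sum>(i, j)\<in>E. lam i j * \<bar>g j - g i\<bar>)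
      + (\<Sum>(i, j)\<in>E. z i j * ((g i - f i) - (g j - f j)))"
    unfolding sum.distrib[symmetric] case_prod_unfold
    by (rule sum_mono) (use subgradient in auto)
  \<comment> \<open>Stationarity tested on \<open>g - f\<close> identifies the linear terms of the
    two inequalities, which cancel when these are added.\<close>
  ultimately show "objective V E w y lam f \<le> objective V E w y lam g"
    using stationary[of "\<lambda>i. g i - f i"]
    by (simp add: objective_def flip: sum_divide_distrib)
qed

end
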